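(* Let $G=(V,E)$ be a finite connected graph with $|V|\ge3$, $x_0\in V$, and for $\delta>0$ let $$I_\delta(\nu)=\inf_{(\nu_k,r_k,E_k,q_k)_{k}\in\mathscr{A}(\nu)}\ \sum_{k=1}^{\mathfrak{b}} r_k\int_V R\big(q_k(x,\cdot)\,\|\,p_{E_k}(x,\cdot)\big)\,\nu_k(dx),\qquad \nu\in\mathscr{P}(V)$$ (where $p_{E_k}$ depends on $\delta$). Then: (a) For any $\delta\in(0,1)$, $I_\delta(\mu)=I_1(\mu)$ for all $\mu\in\mathscr{P}(V)$. (b) $I_\delta$ is monotonically decreasing in $\delta\ge1$: for all $\delta_2>\delta_1\ge1$, $I_{\delta_1}(\mu)\ge I_{\delta_2}(\mu)$ for all $\mu\in\mathscr{P}(V)$; and there exists $\mu_0\in\mathscr{P}(V)$ (depending on $\delta_1,\delta_2$) with $I_{\delta_1}(\mu_0)>I_{\delta_2}(\mu_0)$. (c) $I_\delta$ is uniformly continuous in $\delta$ in the sense that $$\lim_{|\delta_1-\delta_2|\to0}\ \sup_{\mu\in\mathscr{P}(V):\,I_1(\mu)<\infty}|I_{\delta_1}(\mu)-I_{\delta_2}(\mu)|=0 .$$ (d) For some $\mu\in\mathscr{P}(V)$, the function $\delta\mapsto I_\delta(\mu)$ is not differentiable at $\delta=1$.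
   Context: Graphs are undirected and simple; an edge is a set $uv=\{u,v\}$, $u\sim v$ means adjacency, $\mathfrak{b}=|E|$, and $\mathscr{P}(V)$ is the set of probability measures on $V$. ($I_\delta$ is the large deviation rate function of the empirical measures of the once-reinforced random walk with parameter $\delta$ on $G$ started at $x_0$.) Relative entropy: $R(\gamma\|\rho)=\int\frac{d\gamma}{d\rho}\log\frac{d\gamma}{d\rho}\,d\rho$ if $\gamma\ll\rho$, and $\infty$ otherwise. The infimum over the empty set is $\infty$. $\mathscr{E}$ is the set of sequences $(E_k)_{1\le k\le\mathfrak{b}}$ of subsets of $E$ with: $E_k\subset E_{k+1}$ for $1\le k<\mathfrak b$; $|E_k|=k$; $E_1=\{x_0v\}$ for some $v\in V$; and the unique edge of $E_{k+1}\setminus E_k$ shares a vertex with some edge of $E_k$. $V_k$ denotes the set of endpoints of edges in $E_k$. For $E'\subseteq E$: $p_{E'}(x,y)=\dfrac{g(xy)}{\sum_{z\sim x}g(xz)}$ if $y\sim x$ and $0$ otherwise, where $g(e)=\delta$ if $e\in E'$ and $g(e)=1$ if $e\notin E'$. For $E'\subseteq E$ with set of endpoints $V'$, $\mathscr{T}(E')$ is the set of transition probabilities $q:V'\times V\to[0,1]$ with $\sum_{z\in V}q(x,z)=1$ for each $x$ and $q(x,y)>0$ only if $xy\in E'$. For $\nu\in\mathscr{P}(V)$, $\mathscr{A}(\nu)$ is the set of families $(\nu_k,r_k,E_k,q_k)_{1\le k\le\mathfrak{b}}$ with $(E_k)_k\in\mathscr{E}$; $r_k\ge0$, $\sum_{k}r_k=1$;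 $q_k\in\mathscr{T}(E_k)$; $\nu_k\in\mathscr{P}(V_k)$ (viewed as a measure on $V$) with $\nu_kq_k=\nu_k$; and $\sum_{k}r_k\nu_k=\nu$. The limit in (c) means: for every $\varepsilon>0$ there is $\eta>0$ such that for all $\delta_1,\delta_2>0$ with $|\delta_1-\delta_2|<\eta$ the supremum is less than $\varepsilon$. *)

theory Defs
  imports "HOL-Probability.Probability"
begin

definition finite_simple_graph :: "'a set \<Rightarrow> 'a set set \<Rightarrow> bool" where
  "finite_simple_graph V E \<longleftrightarrow>
     finite V \<and> (\<forall>e\<in>E. \<exists>u\<in>V. \<exists>v\<in>V. u \<noteq> v \<and> e = {u, v})"

definition connected_graph :: "'a set \<Rightarrow> 'a set set \<Rightarrow> bool" where
  "connected_graph V E \<longleftrightarrow> (\<forall>u\<in>V. \<forall>v\<in>V. (u, v) \<in> {(x, y). {x, y} \<in> E}\<^sup>*)"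

text \<open>Probability measures on a finite set are probability mass functions
  supported in that set.  In particular, a measure on a subset of \<open>V\<close> is a
  measure on \<open>V\<close> without any coercion.\<close>

definition prob_on :: "'a set \<Rightarrow> 'a pmf set" where
  "prob_on V = {\<mu>. set_pmf \<mu> \<subseteq> V}"

text \<open>Relative entropy \<open>R(\<gamma>\<parallel>\<rho>)\<close> (natural logarithm).  The integral is nonnegative by
  Jensen's inequality, so the coercion \<open>ennreal\<close> does not truncate it; since the library
  has \<open>ln 0 = 0\<close>, the convention \<open>0 log 0 = 0\<close> is built in.  The Bochner integral is
  only meaningful for an integrable integrand, which is automatic here because \<open>\<rho>\<close> is
  always finitely supported.\<close>

definition rel_entropy :: "'a pmf \<Rightarrow> 'a pmf \<Rightarrow> ennreal" where
  "rel_entropy \<gamma> \<rho> =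
     (if absolutely_continuous (measure_pmf \<rho>) (measure_pmf \<gamma>)
      then ennreal (\<integral>x. (let f = enn2real (RN_deriv (measure_pmf \<rho>) (measure_pmf \<gamma>) x)
                         in f * ln f) \<partial>measure_pmf \<rho>)
      else \<infinity>)"

text \<open>Only the values at indices in \<open>{1..card E}\<close> matter.  The difference of two
  consecutive sets is a singleton, so \<open>\<forall>e \<in> F (Suc k) - F k\<close> speaks about its unique
  element.\<close>

definition edge_seqs :: "'a set \<Rightarrow> 'a set set \<Rightarrow> 'a \<Rightarrow> (nat \<Rightarrow> 'a set set) set" where
  "edge_seqs V E x0 = {F.
     (\<forall>k\<in>{1..card E}. F k \<subseteq> E \<and> card (F k) = k) \<and>
     (\<forall>k\<in>{1..<card E}. F k \<subseteq> F (Suc k)) \<and>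
     (\<exists>v\<in>V. F 1 = {{x0, v}}) \<and>
     (\<forall>k\<in>{1..<card E}. \<forall>e\<in>F (Suc k) - F k. \<exists>e'\<in>F k. e \<inter> e' \<noteq> {})}"

definition edge_weight :: "real \<Rightarrow> 'a set set \<Rightarrow> 'a set \<Rightarrow> real" where
  "edge_weight \<delta> E' e = (if e \<in> E' then \<delta> else 1)"

text \<open>The kernel \<open>p\<^bsub>E'\<^esub>(x,\<cdot>)\<close> with parameter \<open>\<delta>\<close>; the lemma \<open>pmf_rw_kernel\<close> below shows that
  the given weights really form a probability mass function.\<close>

definition rw_kernel :: "'a set \<Rightarrow> 'a set set \<Rightarrow> real \<Rightarrow> 'a set set \<Rightarrow> 'a \<Rightarrow> 'a pmf" where
  "rw_kernel V E \<delta> E' x = embed_pmf (\<lambda>y.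
     if {x, y} \<in> E
     then edge_weight \<delta> E' {x, y} / (\<Sum>z\<in>{z\<in>V. {x, z} \<in> E}. edge_weight \<delta> E' {x, z})
     else 0)"

text \<open>Transition probabilities are total functions, constrained only on the endpoint
  set \<open>\<Union>E'\<close>; values elsewhere are irrelevant.\<close>

definition transitions :: "'a set \<Rightarrow> 'a set set \<Rightarrow> ('a \<Rightarrow> 'a pmf) set" where
  "transitions V E' = {q. \<forall>x\<in>\<Union>E'. q x \<in> prob_on V \<and> (\<forall>y\<in>V. pmf (q x) y > 0 \<longrightarrow> {x, y} \<in> E')}"

definition admissible ::
  "'a set \<Rightarrow> 'a set set \<Rightarrow> 'a \<Rightarrow> 'a pmf \<Rightarrow>
     ((nat \<Rightarrow> 'a pmf) \<times> (nat \<Rightarrow> real) \<times> (nat \<Rightarrow> 'a set set) \<times> (nat \<Rightarrow> 'a \<Rightarrow> 'a pmf)) set" where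
  "admissible V E x0 \<nu> = {(n, r, F, q).
     F \<in> edge_seqs V E x0 \<and>
     (\<forall>k\<in>{1..card E}. r k \<ge> 0) \<and> (\<Sum>k\<in>{1..card E}. r k) = 1 \<and>
     (\<forall>k\<in>{1..card E}. q k \<in> transitions V (F k)) \<and>
     (\<forall>k\<in>{1..card E}. n k \<in> prob_on (\<Union>(F k)) \<and> bind_pmf (n k) (q k) = n k) \<and>
     (\<forall>x\<in>V. (\<Sum>k\<in>{1..card E}. r k * pmf (n k) x) = pmf \<nu> x)}"

text \<open>The value is \<open>\<infinity>\<close> (the infimum of the empty set) if no family is admissible.\<close>

definition rate :: "'a set \<Rightarrow> 'a set set \<Rightarrow> 'a \<Rightarrow> real \<Rightarrow> 'a pmf \<Rightarrow> ereal" where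
  "rate V E x0 \<delta> \<nu> = (INF (n, r, F, q) \<in> admissible V E x0 \<nu>.
     enn2ereal (\<Sum>k\<in>{1..card E}. ennreal (r k) *
       (\<integral>\<^sup>+x. rel_entropy (q k x) (rw_kernel V E \<delta> (F k) x) \<partial>measure_pmf (n k))))"

lemma pmf_rw_kernel:
  assumes G: "finite_simple_graph V E" "connected_graph V E" and "card V \<ge> 2"
    and "x \<in> V" and "\<delta> > 0"
  shows "pmf (rw_kernel V E \<delta> E' x) y =
    (if {x, y} \<in> E
     then edge_weight \<delta> E' {x, y} / (\<Sum>z\<in>{z\<in>V. {x, z} \<in> E}. edge_weight \<delta> E' {x, z})
     else 0)"
proof -
  let ?N = "{z\<in>V. {x, z} \<in> E}"
  let ?S = "\<Sum>z\<in>?N. edge_weight \<delta> E' {x, z}"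
  let ?f = "\<lambda>y. if {x, y} \<in> E then edge_weight \<delta> E' {x, y} / ?S else 0"
  have fin: "finite ?N" using G(1) by (auto simp: finite_simple_graph_def)
  have pos: "edge_weight \<delta> E' e > 0" for e using \<open>\<delta> > 0\<close> by (auto simp: edge_weight_def)
  have inV: "y \<in> V" if "{x, y} \<in> E" for y
    using G(1) that by (fastforce simp: finite_simple_graph_def doubleton_eq_iff)
  obtain y0 where "y0 \<in> V" "y0 \<noteq> x"
    using \<open>card V \<ge> 2\<close> \<open>x \<in> V\<close> by (metis card_2_iff' ex_card subsetD)
  then have "(x, y0) \<in> {(x, y). {x, y} \<in> E}\<^sup>*"
    using G(2) \<open>x \<in> V\<close> by (auto simp: connected_graph_def)
  then obtain z where "{x, z} \<in> E" using \<open>y0 \<noteq> x\<close> by (auto elim: converse_rtranclE)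
  then have ne: "?N \<noteq> {}" using inV by auto
  have S: "?S > 0" using fin ne pos by (intro sum_pos) auto
  have nn: "?f y \<ge> 0" for y using S pos[of "{x, y}"] by (auto intro: less_imp_le)
  have "(\<integral>\<^sup>+y. ennreal (?f y) \<partial>count_space UNIV) = (\<Sum>y\<in>?N. ennreal (?f y))"
    using fin inV by (intro nn_integral_count_space') (auto split: if_splits)
  also have "\<dots> = ennreal (\<Sum>y\<in>?N. ?f y)" by (intro sum_ennreal nn)
  also have "(\<Sum>y\<in>?N. ?f y) = (\<Sum>y\<in>?N. edge_weight \<delta> E' {x, y} / ?S)"
    by (intro sum.cong) auto
  also have "\<dots> = 1" using S by (simp flip: sum_divide_distrib)
  finally have "(\<integral>\<^sup>+y. ennreal (?f y) \<partial>count_space UNIV) = 1" by simp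
  with nn show ?thesis unfolding rw_kernel_def by (subst pmf_embed_pmf) auto
qed

end

theory Submission
  imports Defs
begin

text \<open>If \<open>q(x, \<cdot>)\<close> is supported on the neighbours of \<open>x\<close> along explored edges, then
  \<open>R(q(x, \<cdot>)\<parallel>p\<^bsub>F\<^esub>(x, \<cdot>)) = \<Sum>\<^sub>y q(x, y) ln q(x, y) + ln D\<close> with \<open>D = d\<^sub>F(x) + (d(x) - d\<^sub>F(x)) / \<delta>\<close>,
  where \<open>d\<close> and \<open>d\<^sub>F\<close> are the degrees in \<open>E\<close> and in \<open>F\<close>.  So the parameter enters only through
  \<open>ln D\<close>, which is antitone in \<open>\<delta>\<close> and 1-Lipschitz on \<open>\<delta> \<ge> 1\<close>; this gives monotonicity
  and uniform continuity.  For \<open>\<delta> \<le> 1\<close> one has \<open>D \<ge> d(x)\<close>, with equality for \<open>F = E\<close>, so by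
  convexity of \<open>x ln x\<close> averaging all kernels into a single one on the full edge set does not
  increase the cost, and the rate does not depend on \<open>\<delta>\<close>.  Finally, for the uniform measure on
  an edge \<open>{x0, v}\<close> the kernel is forced to swap the endpoints, and for \<open>\<delta> \<ge> 1\<close> the rate is
  \<open>(ln (1 + (d(x0) - 1) / \<delta>) + ln (1 + (d(v) - 1) / \<delta>)) / 2\<close>.  One of the degrees exceeds \<open>1\<close>,
  so this is strictly decreasing with negative slope at \<open>1\<close>, while the rate is constant on
  \<open>(0, 1]\<close>.\<close>

subsection \<open>Relative entropy and convexity\<close>

text \<open>On a discrete space the Radon-Nikodym derivative is the quotient of the two mass
  functions. It is determined only almost everywhere, which for a \<open>pmf\<close> means on the
  support, and the integral sees nothing else.\<close>

lemma rel_entropy_finite_support: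
  assumes fin: "finite A" and \<rho>: "set_pmf \<rho> \<subseteq> A" and sub: "set_pmf \<gamma> \<subseteq> set_pmf \<rho>"
  shows "rel_entropy \<gamma> \<rho> = ennreal (\<Sum>y\<in>A. pmf \<gamma> y * ln (pmf \<gamma> y / pmf \<rho> y))"
proof -
  let ?f = "\<lambda>y. pmf \<gamma> y / pmf \<rho> y"
  have \<rho>0: "pmf \<gamma> y = 0" if "pmf \<rho> y = 0" for y
    using sub that by (auto simp: set_pmf_iff)
  have ac: "absolutely_continuous (measure_pmf \<rho>) (measure_pmf \<gamma>)"
    unfolding absolutely_continuous_def
  proof
    fix A assume "A \<in> null_sets (measure_pmf \<rho>)"
    then have "AE y in measure_pmf \<rho>. y \<notin> A" by (rule AE_not_in)
    then have "A \<inter> set_pmf \<gamma> = {}" using sub by (auto simp: AE_measure_pmf_iff)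
    then show "A \<in> null_sets (measure_pmf \<gamma>)" by (rule in_null_sets_measure_pmfI)
  qed
  have "density (measure_pmf \<rho>) (\<lambda>y. ennreal (?f y)) = measure_pmf \<gamma>"
    unfolding measure_pmf_eq_density
    by (subst density_density_eq)
       (auto simp: \<rho>0 simp flip: ennreal_mult' intro!: arg_cong[where f = "density _"])
  then have *: "AE y in measure_pmf \<rho>. ennreal (?f y) = RN_deriv (measure_pmf \<rho>) (measure_pmf \<gamma>) y"
    by (intro measure_pmf.RN_deriv_unique) auto
  have rn: "enn2real (RN_deriv (measure_pmf \<rho>) (measure_pmf \<gamma>) y) = ?f y" if "y \<in> set_pmf \<rho>" for y
  proof -
    have "RN_deriv (measure_pmf \<rho>) (measure_pmf \<gamma>) y = ennreal (?f y)"
      using * that by (simp add: AE_measure_pmf_iff)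
    then show ?thesis by simp
  qed
  have "(\<integral>y. (let f = enn2real (RN_deriv (measure_pmf \<rho>) (measure_pmf \<gamma>) y) in f * ln f) \<partial>measure_pmf \<rho>)
      = (\<integral>y. ?f y * ln (?f y) \<partial>measure_pmf \<rho>)"
    by (intro integral_cong_AE) (auto simp: AE_measure_pmf_iff rn Let_def)
  also have "\<dots> = (\<Sum>y\<in>A. ?f y * ln (?f y) * pmf \<rho> y)"
    using fin \<rho> by (intro integral_measure_pmf_real) auto
  also have "\<dots> = (\<Sum>y\<in>A. pmf \<gamma> y * ln (?f y))"
    by (intro sum.cong) (auto simp: \<rho>0)
  finally show ?thesis using ac by (simp add: rel_entropy_def)
qed

text \<open>\<open>x ln x\<close> lies above its tangent at the mean \<open>u\<close>, and averaging
  the tangent inequality with the weights \<open>w\<close> leaves \<open>u ln u\<close>. The tangent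
  at 0 is vertical, so \<open>u = 0\<close> is treated apart; at points with \<open>a k = 0\<close>
  the value \<open>ln 0 = 0\<close> makes the product vanish.\<close>

lemma xlnx_jensen:
  fixes w a :: "'b \<Rightarrow> real"
  assumes "finite S" and w: "\<And>k. k \<in> S \<Longrightarrow> w k \<ge> 0" and w1: "sum w S = 1"
    and a: "\<And>k. k \<in> S \<Longrightarrow> a k \<ge> 0"
  shows "(\<Sum>k\<in>S. w k * a k) * ln (\<Sum>k\<in>S. w k * a k) \<le> (\<Sum>k\<in>S. w k * (a k * ln (a k)))"
proof -
  define u where "u = (\<Sum>k\<in>S. w k * a k)"
  have u0: "u \<ge> 0" unfolding u_def using w a by (intro sum_nonneg) auto
  show ?thesis
  proof (cases "u = 0")
    case True
    then have "\<forall>k\<in>S. w k * a k = 0"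
      unfolding u_def using assms by (subst (asm) sum_nonneg_eq_0_iff) auto
    then have "(\<Sum>k\<in>S. w k * (a k * ln (a k))) = 0"
      by (intro sum.neutral) auto
    then show ?thesis using True by (simp add: u_def)
  next
    case False
    with u0 have u: "u > 0" by simp
    have tangent: "a k * ln u + a k - u \<le> a k * ln (a k)" if "k \<in> S" for k
    proof (cases "a k = 0")
      case False
      with a[OF that] have ak: "a k > 0" by simp
      have "ln (u / a k) \<le> u / a k - 1" using u ak by (intro ln_le_minus_one) auto
      then have "a k * (ln u - ln (a k)) \<le> a k * (u / a k - 1)"
        using u ak by (intro mult_left_mono) (auto simp: ln_div)
      then show ?thesis using ak by (simp add: algebra_simps)
    qed (use u in auto)
    have "u * ln u = (\<Sum>k\<in>S. w k * a k) * ln u + (\<Sum>k\<in>S. w k * a k) - u * sum w S"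
      by (simp add: w1 u_def)
    also have "\<dots> = (\<Sum>k\<in>S. w k * (a k * ln u + a k - u))"
      by (simp add: algebra_simps sum.distrib sum_subtractf sum_distrib_left)
    also have "\<dots> \<le> (\<Sum>k\<in>S. w k * (a k * ln (a k)))"
      using tangent w by (intro sum_mono mult_left_mono) auto
    finally show ?thesis by (simp add: u_def)
  qed
qed

text \<open>The witness is a two-step experiment: draw an index with law \<open>w\<close>, then a
  point with law \<open>q k\<close>.\<close>

lemma pmf_mixture_exists:
  fixes w :: "'b \<Rightarrow> real" and q :: "'b \<Rightarrow> 'a pmf"
  assumes fin: "finite S" and w: "\<And>k. k \<in> S \<Longrightarrow> w k \<ge> 0" and w1: "sum w S = 1"
  shows "\<exists>p. \<forall>y. pmf p y = (\<Sum>k\<in>S. w k * pmf (q k) y)"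
proof -
  let ?f = "\<lambda>k. if k \<in> S then w k else 0"
  have "(\<integral>\<^sup>+k. ennreal (?f k) \<partial>count_space UNIV) = (\<Sum>k\<in>S. ennreal (?f k))"
    using fin by (intro nn_integral_count_space') (auto split: if_splits)
  also have "\<dots> = ennreal (\<Sum>k\<in>S. w k)" using w by simp
  finally have f: "pmf (embed_pmf ?f) k = ?f k" for k
    using w w1 by (subst pmf_embed_pmf) auto
  have "pmf (bind_pmf (embed_pmf ?f) q) y = (\<Sum>k\<in>S. w k * pmf (q k) y)" for y
    unfolding pmf_bind
    by (subst integral_measure_pmf_real[OF fin]) (auto simp: f set_pmf_iff mult.commute split: if_splits)
  then show ?thesis by blast
qed

text \<open>\<open>ennreal\<close> sends negative reals to 0 and is therefore only subadditive. The
  entropy terms below come without a proof of their sign, so this inequality replaces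
  additivity.\<close>

lemma ennreal_sum_le: "ennreal (\<Sum>i\<in>I. f i) \<le> (\<Sum>i\<in>I. ennreal (f i))"
proof (cases "finite I")
  case True
  then show ?thesis
  proof (induction I rule: finite_induct)
    case (insert i I)
    have "ennreal (f i + sum f I) \<le> ennreal (f i) + ennreal (sum f I)"
      by (metis add.commute add_0 ennreal_leI ennreal_neg ennreal_plus le_add_same_cancel1 linorder_linear order_refl add_increasing)
    with insert show ?case by (auto intro: order_trans add_left_mono)
  qed auto
qed auto

text \<open>The difference quotients at 1 tend to 0 from the left and to \<open>d\<close> from the
  right.\<close>

lemma not_differentiable_kink:
  fixes f h :: "real \<Rightarrow> real"
  assumes left: "\<And>x. 0 < x \<Longrightarrow> x \<le> 1 \<Longrightarrow> f x = h 1" and right: "\<And>x. 1 \<le> x \<Longrightarrow> f x = h x"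
    and h: "(h has_real_derivative d) (at 1)" and "d \<noteq> 0"
  shows "\<not> f differentiable (at 1)"
proof
  assume "f differentiable (at 1)"
  then obtain D where "(f has_real_derivative D) (at 1)"
    by (auto simp: real_differentiable_def)
  then have D: "((\<lambda>x. (f x - f 1) / (x - 1)) \<longlongrightarrow> D) (at 1)"
    by (simp add: has_field_derivative_iff)
  have "\<forall>\<^sub>F x in at_left 1. (f x - f 1) / (x - 1) = 0"
    using eventually_at_left_real[of 0 1] left by (auto elim: eventually_mono)
  then have "((\<lambda>x. (f x - f 1) / (x - 1)) \<longlongrightarrow> 0) (at_left 1)"
    by (rule tendsto_eventually)
  moreover have "((\<lambda>x. (f x - f 1) / (x - 1)) \<longlongrightarrow> D) (at_left 1)"
    using D by (simp add: filterlim_at_split)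
  ultimately have "D = 0" by (intro tendsto_unique) auto
  have "((\<lambda>x. (h x - h 1) / (x - 1)) \<longlongrightarrow> d) (at_right 1)"
    using h by (simp add: has_field_derivative_iff filterlim_at_split)
  moreover have "\<forall>\<^sub>F x in at_right 1. (h x - h 1) / (x - 1) = (f x - f 1) / (x - 1)"
    using right by (auto simp: eventually_at_filter)
  ultimately have "((\<lambda>x. (f x - f 1) / (x - 1)) \<longlongrightarrow> d) (at_right 1)"
    by (rule Lim_transform_eventually)
  moreover have "((\<lambda>x. (f x - f 1) / (x - 1)) \<longlongrightarrow> D) (at_right 1)"
    using D by (simp add: filterlim_at_split)
  ultimately have "D = d" by (intro tendsto_unique) auto
  with \<open>D = 0\<close> \<open>d \<noteq> 0\<close> show False by simp
qed

subsection \<open>Cost of admissible families\<close>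

definition nbrs :: "'a set \<Rightarrow> 'a set set \<Rightarrow> 'a \<Rightarrow> 'a set" where
  "nbrs V E x = {z\<in>V. {x, z} \<in> E}"

definition neg_entropy :: "'a set \<Rightarrow> 'a pmf \<Rightarrow> real" where
  "neg_entropy V \<gamma> = (\<Sum>y\<in>V. pmf \<gamma> y * ln (pmf \<gamma> y))"

text \<open>For \<open>{x, y} \<in> F\<close> this is the reciprocal of the transition probability
  \<open>p\<^bsub>F\<^esub>(x, y)\<close>; it does not depend on \<open>y\<close>.\<close>

definition eff_degree :: "'a set \<Rightarrow> 'a set set \<Rightarrow> real \<Rightarrow> 'a set set \<Rightarrow> 'a \<Rightarrow> real" where
  "eff_degree V E \<delta> F x = (\<Sum>z\<in>nbrs V E x. if {x, z} \<in> F then 1 else 1 / \<delta>)"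

definition family_cost :: "'a set \<Rightarrow> 'a set set \<Rightarrow> real \<Rightarrow> (nat \<Rightarrow> 'a pmf) \<Rightarrow> (nat \<Rightarrow> real) \<Rightarrow>
    (nat \<Rightarrow> 'a set set) \<Rightarrow> (nat \<Rightarrow> 'a \<Rightarrow> 'a pmf) \<Rightarrow> ennreal" where
  "family_cost V E \<delta> n r F q = (\<Sum>k\<in>{1..card E}. ennreal (r k) *
     (\<integral>\<^sup>+x. rel_entropy (q k x) (rw_kernel V E \<delta> (F k) x) \<partial>measure_pmf (n k)))"

lemma neg_entropy_return: "finite V \<Longrightarrow> neg_entropy V (return_pmf v) = 0"
  unfolding neg_entropy_def by (intro sum.neutral) (auto simp: pmf_return indicator_def)

lemma rate_le:
  assumes "(n, r, F, q) \<in> admissible V E x0 \<nu>"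
  shows "rate V E x0 \<delta> \<nu> \<le> enn2ereal (family_cost V E \<delta> n r F q)"
  unfolding rate_def family_cost_def by (rule INF_lower2[OF assms]) simp

lemma le_rateI:
  assumes "\<And>n r F q. (n, r, F, q) \<in> admissible V E x0 \<nu> \<Longrightarrow>
    c \<le> enn2ereal (family_cost V E \<delta> n r F q)"
  shows "c \<le> rate V E x0 \<delta> \<nu>"
  unfolding rate_def using assms by (intro INF_greatest) (auto simp: family_cost_def)

lemma rate_nonneg: "0 \<le> rate V E x0 \<delta> \<nu>"
  by (rule le_rateI) simp

section \<open>The graph and bounds on effective degrees\<close>

locale rw_graph =
  fixes V :: "'a set" and E :: "'a set set" and x0 :: 'a
  assumes G: "finite_simple_graph V E" and conn: "connected_graph V E"
    and card_V: "card V \<ge> 3" and x0: "x0 \<in> V"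
begin

lemma finite_V: "finite V"
  using G by (simp add: finite_simple_graph_def)

lemma edge_in_V:
  assumes "{x, y} \<in> E" shows "x \<in> V" "y \<in> V"
  using G assms by (fastforce simp: finite_simple_graph_def doubleton_eq_iff)+

lemma edge_neq: "{x, y} \<in> E \<Longrightarrow> x \<noteq> y"
  using G by (fastforce simp: finite_simple_graph_def doubleton_eq_iff)

lemma edge_cases:
  assumes "e \<in> E"
  obtains x y where "e = {x, y}" "x \<noteq> y" "x \<in> V" "y \<in> V"
  using G assms by (auto simp: finite_simple_graph_def)

lemma finite_E: "finite E"
proof (rule finite_subset)
  show "E \<subseteq> Pow V" by (auto elim: edge_cases)
qed (use finite_V in simp)

lemma finite_nbrs: "finite (nbrs V E x)"
  using finite_V by (simp add: nbrs_def)

lemma neighbour_exists: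
  assumes "x \<in> V"
  obtains z where "{x, z} \<in> E"
proof -
  obtain y where "y \<in> V" "y \<noteq> x"
  proof -
    have "\<not> V \<subseteq> {x}" using card_V card_mono[of "{x}" V] by auto
    then show ?thesis using that by blast
  qed
  then have "(x, y) \<in> {(x, y). {x, y} \<in> E}\<^sup>*"
    using conn \<open>x \<in> V\<close> by (auto simp: connected_graph_def)
  then show ?thesis using \<open>y \<noteq> x\<close> that by (auto elim: converse_rtranclE)
qed

text \<open>Induction along a path from \<open>u\<close>. It is applied to the endpoints of a
  partial edge set and to the pair \<open>{x0, v}\<close>.\<close>

lemma adjacency_closed_imp_superset:
  assumes "u \<in> U" "u \<in> V" and closed: "\<And>x y. x \<in> U \<Longrightarrow> {x, y} \<in> E \<Longrightarrow> y \<in> U"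
  shows "V \<subseteq> U"
proof
  fix v assume "v \<in> V"
  then have "(u, v) \<in> {(x, y). {x, y} \<in> E}\<^sup>*"
    using conn assms by (auto simp: connected_graph_def)
  then show "v \<in> U"
    by (induction rule: rtrancl_induct) (use assms closed in auto)
qed

text \<open>The explored edge \<open>{x, y}\<close> contributes 1, and every other neighbour at
  least \<open>1 / \<delta>\<close> because \<open>\<delta> \<ge> 1\<close>.\<close>

lemma eff_degree_ge:
  assumes "1 \<le> \<delta>" "{x, y} \<in> F" "F \<subseteq> E"
  shows "1 + (real (card (nbrs V E x)) - 1) / \<delta> \<le> eff_degree V E \<delta> F x"
proof -
  have y: "y \<in> nbrs V E x" using assms edge_in_V(2)[of x y] by (auto simp: nbrs_def)
  then have "real (card (nbrs V E x)) = 1 + real (card (nbrs V E x - {y}))"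
    using card_Suc_Diff1[OF finite_nbrs y] by simp
  then have "1 + (real (card (nbrs V E x)) - 1) / \<delta> = 1 + (\<Sum>z\<in>nbrs V E x - {y}. 1 / \<delta>)"
    by simp
  also have "\<dots> \<le> 1 + (\<Sum>z\<in>nbrs V E x - {y}. if {x, z} \<in> F then 1 else 1 / \<delta>)"
    using assms by (intro add_left_mono sum_mono) auto
  also have "\<dots> = eff_degree V E \<delta> F x"
    unfolding eff_degree_def using assms by (subst sum.remove[OF finite_nbrs y]) simp
  finally show ?thesis .
qed

text \<open>The equality case of the preceding bound: no edge at \<open>x\<close> other than
  \<open>{x, y}\<close> is explored.\<close>

lemma eff_degree_edge:
  assumes "{x, y} \<in> E"
  shows "eff_degree V E \<delta> {{x, y}} x = 1 + (real (card (nbrs V E x)) - 1) / \<delta>"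
proof -
  have y: "y \<in> nbrs V E x" using assms edge_in_V by (auto simp: nbrs_def)
  then have "card (nbrs V E x) \<ge> 1" using finite_nbrs[of x] by (simp add: Suc_le_eq card_gt_0_iff, blast)
  have "(\<Sum>z\<in>nbrs V E x - {y}. if {x, z} \<in> {{x, y}} then 1 else 1 / \<delta>) = (\<Sum>z\<in>nbrs V E x - {y}. 1 / \<delta>)"
    by (intro sum.cong) (auto simp: doubleton_eq_iff)
  also have "\<dots> = (real (card (nbrs V E x)) - 1) / \<delta>"
    using y finite_nbrs \<open>card (nbrs V E x) \<ge> 1\<close> by (simp add: of_nat_diff)
  finally show ?thesis
    unfolding eff_degree_def by (subst sum.remove[OF finite_nbrs y]) simp
qed

lemma eff_degree_full: "eff_degree V E \<delta> E x = card (nbrs V E x)"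
  unfolding eff_degree_def by (simp add: nbrs_def)

lemma eff_degree_ge_card:
  assumes "0 < \<delta>" "\<delta> \<le> 1"
  shows "card (nbrs V E x) \<le> eff_degree V E \<delta> F x"
proof -
  have "(\<Sum>z\<in>nbrs V E x. 1) \<le> eff_degree V E \<delta> F x"
    unfolding eff_degree_def using assms by (intro sum_mono) auto
  then show ?thesis by simp
qed

lemma eff_degree_pos:
  assumes "0 < \<delta>" "x \<in> V"
  shows "0 < eff_degree V E \<delta> F x"
proof -
  obtain z where "{x, z} \<in> E" using neighbour_exists \<open>x \<in> V\<close> .
  then have "nbrs V E x \<noteq> {}" using edge_in_V(2)[of x z] by (auto simp: nbrs_def)
  then show ?thesis unfolding eff_degree_def using finite_nbrs assms by (intro sum_pos) auto
qed

lemma eff_degree_antimono: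
  assumes "0 < \<delta>1" "\<delta>1 \<le> \<delta>2"
  shows "eff_degree V E \<delta>2 F x \<le> eff_degree V E \<delta>1 F x"
  unfolding eff_degree_def using assms by (intro sum_mono) (auto simp: frac_le)

text \<open>Each summand changes by a factor of at most \<open>\<delta>2 / \<delta>1\<close>, whose
  logarithm is at most \<open>(\<delta>2 - \<delta>1) / \<delta>1\<close>. The condition
  \<open>\<delta>1 \<ge> 1\<close> then removes the denominator.\<close>

lemma ln_eff_degree_lipschitz:
  assumes "1 \<le> \<delta>1" "\<delta>1 \<le> \<delta>2" "x \<in> V"
  shows "ln (eff_degree V E \<delta>1 F x) \<le> ln (eff_degree V E \<delta>2 F x) + (\<delta>2 - \<delta>1)"
proof -
  have "eff_degree V E \<delta>1 F x \<le> (\<delta>2 / \<delta>1) * eff_degree V E \<delta>2 F x"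
    unfolding eff_degree_def sum_distrib_left using assms
    by (intro sum_mono) auto
  then have "ln (eff_degree V E \<delta>1 F x) \<le> ln ((\<delta>2 / \<delta>1) * eff_degree V E \<delta>2 F x)"
    using assms eff_degree_pos[of \<delta>1 x F] by (intro ln_mono) auto
  also have "\<dots> = ln (\<delta>2 / \<delta>1) + ln (eff_degree V E \<delta>2 F x)"
    using assms eff_degree_pos[of \<delta>2 x F] by (intro ln_mult_pos) auto
  also have "ln (\<delta>2 / \<delta>1) \<le> \<delta>2 / \<delta>1 - 1"
    using assms by (intro ln_le_minus_one) auto
  also have "\<delta>2 / \<delta>1 - 1 = (\<delta>2 - \<delta>1) / \<delta>1"
    using assms by (simp add: field_simps)
  also have "\<dots> \<le> \<delta>2 - \<delta>1"
    using assms by (simp add: divide_le_eq mult_le_cancel_left1)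
  finally show ?thesis by simp
qed

text \<open>The normalising sum of the kernel is \<open>\<delta> * ?D\<close>, so every explored
  edge at \<open>x\<close> has probability \<open>1 / ?D\<close>. This is constant on the support of
  \<open>\<gamma>\<close>, and the logarithm of the quotient splits.\<close>

lemma rel_entropy_rw_kernel:
  assumes "x \<in> V" "0 < \<delta>" "F \<subseteq> E" and supp: "\<And>y. y \<in> set_pmf \<gamma> \<Longrightarrow> {x, y} \<in> F"
  shows "rel_entropy \<gamma> (rw_kernel V E \<delta> F x) = ennreal (neg_entropy V \<gamma> + ln (eff_degree V E \<delta> F x))"
proof -
  let ?D = "eff_degree V E \<delta> F x"
  let ?\<rho> = "rw_kernel V E \<delta> F x"
  have D: "?D > 0" using eff_degree_pos assms by blast
  have S: "(\<Sum>z\<in>{z\<in>V. {x, z} \<in> E}. edge_weight \<delta> F {x, z}) = \<delta> * ?D"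
    unfolding eff_degree_def nbrs_def sum_distrib_left using \<open>\<delta> > 0\<close>
    by (intro sum.cong) (auto simp: edge_weight_def)
  have \<rho>: "pmf ?\<rho> y = (if {x, y} \<in> E then edge_weight \<delta> F {x, y} / (\<delta> * ?D) else 0)" for y
    unfolding S[symmetric] by (rule pmf_rw_kernel) (use G conn card_V assms in auto)
  have set: "set_pmf ?\<rho> = {y. {x, y} \<in> E}"
    using \<open>\<delta> > 0\<close> D by (auto simp: set_pmf_iff \<rho> edge_weight_def split: if_splits)
  have \<gamma>V: "set_pmf \<gamma> \<subseteq> V" using supp \<open>F \<subseteq> E\<close> edge_in_V by blast
  have "pmf \<gamma> y * ln (pmf \<gamma> y / pmf ?\<rho> y) = pmf \<gamma> y * ln (pmf \<gamma> y) + pmf \<gamma> y * ln ?D" for y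
  proof (cases "y \<in> set_pmf \<gamma>")
    case True
    then have "pmf ?\<rho> y = 1 / ?D" and "pmf \<gamma> y > 0"
      using supp \<open>F \<subseteq> E\<close> \<open>\<delta> > 0\<close> by (auto simp: \<rho> edge_weight_def pmf_positive)
    then show ?thesis using D by (simp add: ln_mult_pos algebra_simps)
  qed (simp add: set_pmf_iff)
  then have "(\<Sum>y\<in>V. pmf \<gamma> y * ln (pmf \<gamma> y / pmf ?\<rho> y)) = neg_entropy V \<gamma> + (\<Sum>y\<in>V. pmf \<gamma> y) * ln ?D"
    by (simp add: neg_entropy_def sum.distrib sum_distrib_right)
  moreover have "(\<Sum>y\<in>V. pmf \<gamma> y) = 1" using sum_pmf_eq_1[OF finite_V \<gamma>V] .
  moreover have "rel_entropy \<gamma> ?\<rho> = ennreal (\<Sum>y\<in>V. pmf \<gamma> y * ln (pmf \<gamma> y / pmf ?\<rho> y))"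
    using set supp \<open>F \<subseteq> E\<close> edge_in_V by (intro rel_entropy_finite_support finite_V) auto
  ultimately show ?thesis by simp
qed

section \<open>Edge sequences and the cost of a fixed family\<close>

lemma edge_seqsD:
  assumes "F \<in> edge_seqs V E x0" "k \<in> {1..card E}"
  shows "F k \<subseteq> E" "card (F k) = k"
  using assms by (auto simp: edge_seqs_def)

lemma card_E_pos: "1 \<le> card E"
proof -
  have "E \<noteq> {}" using neighbour_exists[OF x0] by auto
  then show ?thesis using finite_E by (simp add: Suc_le_eq card_gt_0_iff)
qed

lemma edge_seqs_last: "F \<in> edge_seqs V E x0 \<Longrightarrow> F (card E) = E"
  using edge_seqsD[of F "card E"] card_E_pos finite_E by (intro card_subset_eq) auto

lemma Union_E: "\<Union>E = V"
proof
  show "\<Union>E \<subseteq> V" by (auto elim: edge_cases)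
  show "V \<subseteq> \<Union>E"
  proof
    fix x assume "x \<in> V"
    then obtain z where "{x, z} \<in> E" by (rule neighbour_exists)
    then show "x \<in> \<Union>E" by blast
  qed
qed

context
  fixes n r F q \<nu>
  assumes adm: "(n, r, F, q) \<in> admissible V E x0 \<nu>"
begin

lemma admF: "F \<in> edge_seqs V E x0"
  using adm by (simp add: admissible_def)

lemma adm_r: "k \<in> {1..card E} \<Longrightarrow> 0 \<le> r k" "(\<Sum>k\<in>{1..card E}. r k) = 1"
  using adm by (auto simp: admissible_def)

lemma adm_q: "k \<in> {1..card E} \<Longrightarrow> q k \<in> transitions V (F k)"
  using adm by (auto simp: admissible_def)

lemma adm_n:
  assumes "k \<in> {1..card E}"
  shows "bind_pmf (n k) (q k) = n k" "set_pmf (n k) \<subseteq> \<Union>(F k)" "set_pmf (n k) \<subseteq> V"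
proof -
  show "bind_pmf (n k) (q k) = n k" and *: "set_pmf (n k) \<subseteq> \<Union>(F k)"
    using adm assms by (auto simp: admissible_def prob_on_def)
  then show "set_pmf (n k) \<subseteq> V"
    using edge_seqsD(1)[OF admF assms] Union_E by blast
qed

lemma adm_q_edge:
  assumes "k \<in> {1..card E}" "x \<in> set_pmf (n k)" "y \<in> set_pmf (q k x)"
  shows "{x, y} \<in> F k"
proof -
  have "x \<in> \<Union>(F k)" using adm_n(2)[OF assms(1)] assms(2) by blast
  then have "set_pmf (q k x) \<subseteq> V" "\<forall>y\<in>V. pmf (q k x) y > 0 \<longrightarrow> {x, y} \<in> F k"
    using adm_q[OF assms(1)] by (auto simp: transitions_def prob_on_def)
  then show ?thesis using assms(3) by (auto simp: pmf_positive)
qed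

lemma adm_mixture:
  assumes "\<nu> \<in> prob_on V"
  shows "(\<Sum>k\<in>{1..card E}. r k * pmf (n k) x) = pmf \<nu> x"
proof (cases "x \<in> V")
  case True
  then show ?thesis using adm by (simp add: admissible_def)
next
  case False
  then have "pmf (n k) x = 0" if "k \<in> {1..card E}" for k
    using adm_n(3)[OF that] by (auto simp: set_pmf_iff)
  moreover have "pmf \<nu> x = 0" using False assms by (auto simp: prob_on_def set_pmf_iff)
  ultimately show ?thesis by simp
qed

lemma adm_weight_zero:
  assumes "\<nu> \<in> prob_on V" "pmf \<nu> x = 0" "k \<in> {1..card E}"
  shows "r k * pmf (n k) x = 0"
proof -
  have "(\<Sum>k\<in>{1..card E}. r k * pmf (n k) x) = 0"
    using adm_mixture[OF assms(1), of x] assms(2) by simp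
  then show ?thesis
    using adm_r(1) assms(3) by (subst (asm) sum_nonneg_eq_0_iff) auto
qed

text \<open>The entropy formula is needed only on the support of \<open>n k\<close>, where
  \<open>q k\<close> moves along edges of \<open>F k\<close>; elsewhere the weight
  \<open>pmf (n k) x\<close> is 0. The parameter is now confined to one logarithm per term.\<close>

lemma family_cost_eq:
  assumes "0 < \<delta>"
  shows "family_cost V E \<delta> n r F q = (\<Sum>k\<in>{1..card E}. \<Sum>x\<in>V. ennreal (r k * pmf (n k) x) *
    ennreal (neg_entropy V (q k x) + ln (eff_degree V E \<delta> (F k) x)))"
  unfolding family_cost_def
proof (rule sum.cong[OF refl])
  fix k assume k: "k \<in> {1..card E}"
  let ?R = "\<lambda>x. ennreal (neg_entropy V (q k x) + ln (eff_degree V E \<delta> (F k) x))"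
  have "(\<integral>\<^sup>+x. rel_entropy (q k x) (rw_kernel V E \<delta> (F k) x) \<partial>measure_pmf (n k))
      = (\<integral>\<^sup>+x. ?R x \<partial>measure_pmf (n k))"
    by (intro nn_integral_cong_AE AE_pmfI rel_entropy_rw_kernel)
       (use adm_n[OF k] adm_q_edge[OF k] edge_seqsD(1)[OF admF k] assms in auto)
  also have "\<dots> = (\<Sum>x\<in>V. ?R x * pmf (n k) x)"
    using adm_n(3)[OF k] finite_V
    by (intro nn_integral_measure_pmf_support) (auto simp: set_pmf_iff)
  finally show "ennreal (r k) * (\<integral>\<^sup>+x. rel_entropy (q k x) (rw_kernel V E \<delta> (F k) x) \<partial>measure_pmf (n k))
      = (\<Sum>x\<in>V. ennreal (r k * pmf (n k) x) * ?R x)"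
    using adm_r(1)[OF k] by (simp add: sum_distrib_left ennreal_mult' mult_ac)
qed

text \<open>This turns a bound that is uniform in \<open>k\<close> and \<open>x\<close> into the
  same bound for the whole cost.\<close>

lemma total_weight: "(\<Sum>k\<in>{1..card E}. \<Sum>x\<in>V. ennreal (r k * pmf (n k) x)) = 1"
proof -
  have "(\<Sum>k\<in>{1..card E}. \<Sum>x\<in>V. ennreal (r k * pmf (n k) x))
      = (\<Sum>k\<in>{1..card E}. ennreal (r k * (\<Sum>x\<in>V. pmf (n k) x)))"
    using adm_r by (intro sum.cong) (auto simp: sum_distrib_left)
  also have "\<dots> = (\<Sum>k\<in>{1..card E}. ennreal (r k))"
    by (intro sum.cong) (auto simp: sum_pmf_eq_1[OF finite_V adm_n(3)])
  also have "\<dots> = 1" using adm_r by (subst sum_ennreal) auto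
  finally show ?thesis .
qed

lemma family_cost_antimono:
  assumes "0 < \<delta>1" "\<delta>1 \<le> \<delta>2"
  shows "family_cost V E \<delta>2 n r F q \<le> family_cost V E \<delta>1 n r F q"
  using assms eff_degree_pos
  by (simp add: family_cost_eq)
     (intro sum_mono mult_left_mono ennreal_leI add_left_mono ln_mono eff_degree_antimono; simp)

lemma family_cost_lipschitz:
  assumes "1 \<le> \<delta>1" "\<delta>1 \<le> \<delta>2"
  shows "family_cost V E \<delta>1 n r F q \<le> family_cost V E \<delta>2 n r F q + ennreal (\<delta>2 - \<delta>1)"
proof -
  let ?R = "\<lambda>\<delta> k x. ennreal (neg_entropy V (q k x) + ln (eff_degree V E \<delta> (F k) x))"
  have le: "?R \<delta>1 k x \<le> ?R \<delta>2 k x + ennreal (\<delta>2 - \<delta>1)" if "x \<in> V" for k x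
  proof -
    let ?a = "neg_entropy V (q k x) + ln (eff_degree V E \<delta>2 (F k) x)"
    have "?R \<delta>1 k x \<le> ennreal (?a + (\<delta>2 - \<delta>1))"
      using ln_eff_degree_lipschitz[OF assms that, of "F k"] by (intro ennreal_leI) simp
    also have "\<dots> \<le> ennreal ?a + ennreal (\<delta>2 - \<delta>1)"
      \<comment> \<open>Subadditivity for two reals, obtained as a sum over the two elements of
        \<open>bool\<close>.\<close>
      using ennreal_sum_le[of "\<lambda>b. if b then ?a else \<delta>2 - \<delta>1" UNIV] by (simp add: UNIV_bool add.commute)
    finally show ?thesis .
  qed
  have "family_cost V E \<delta>1 n r F q \<le>
      (\<Sum>k\<in>{1..card E}. \<Sum>x\<in>V. ennreal (r k * pmf (n k) x) * (?R \<delta>2 k x + ennreal (\<delta>2 - \<delta>1)))"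
    using assms le by (simp add: family_cost_eq) (intro sum_mono mult_left_mono; simp)
  also have "\<dots> = family_cost V E \<delta>2 n r F q +
      (\<Sum>k\<in>{1..card E}. \<Sum>x\<in>V. ennreal (r k * pmf (n k) x)) * ennreal (\<delta>2 - \<delta>1)"
    using assms by (simp add: family_cost_eq distrib_left sum.distrib sum_distrib_right)
  finally show ?thesis unfolding total_weight by simp
qed

end

subsection \<open>Dependence of the rate on the parameter\<close>

lemma stage_weight:
  assumes adm: "(n, r, F, q) \<in> admissible V E x0 \<nu>" and \<nu>: "\<nu> \<in> prob_on V"
  shows "(\<Sum>k\<in>{1..card E}. ennreal (r k * pmf (n k) x)) = ennreal (pmf \<nu> x)"
proof -
  have "(\<Sum>k\<in>{1..card E}. ennreal (r k * pmf (n k) x)) = ennreal (\<Sum>k\<in>{1..card E}. r k * pmf (n k) x)"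
    using adm_r(1)[OF adm] by (intro sum_ennreal) auto
  then show ?thesis by (simp only: adm_mixture[OF adm \<nu>])
qed

text \<open>\<open>p\<close> is the law of the next step given that the current point is
  \<open>x\<close>, with stage \<open>k\<close> drawn with weight \<open>r k\<close>. The equation
  stays multiplied by \<open>pmf \<nu> x\<close>, so at points of mass 0 both sides vanish and any
  \<open>p\<close> serves.\<close>

lemma mixed_kernel_exists:
  assumes adm: "(n, r, F, q) \<in> admissible V E x0 \<nu>" and \<nu>: "\<nu> \<in> prob_on V"
  shows "\<exists>p. \<forall>y. pmf \<nu> x * pmf p y = (\<Sum>k\<in>{1..card E}. r k * pmf (n k) x * pmf (q k x) y)"
proof (cases "pmf \<nu> x = 0")
  case True
  have "(\<Sum>k\<in>{1..card E}. r k * pmf (n k) x * pmf (q k x) y) = 0" for y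
    using adm_weight_zero[OF adm \<nu> True] by (intro sum.neutral) auto
  then show ?thesis using True by simp
next
  case False
  have "\<exists>p. \<forall>y. pmf p y = (\<Sum>k\<in>{1..card E}. (r k * pmf (n k) x / pmf \<nu> x) * pmf (q k x) y)"
    using adm_r(1)[OF adm] False adm_mixture[OF adm \<nu>, of x]
    by (intro pmf_mixture_exists) (auto simp flip: sum_divide_distrib)
  then obtain p where "\<And>y. pmf p y = (\<Sum>k\<in>{1..card E}. (r k * pmf (n k) x / pmf \<nu> x) * pmf (q k x) y)"
    by blast
  then have "pmf \<nu> x * pmf p y = (\<Sum>k\<in>{1..card E}. r k * pmf (n k) x * pmf (q k x) y)" for y
    using False by (simp add: sum_distrib_left)
  then show ?thesis by blast
qed

text \<open>Jensen for each target \<open>y\<close>, with weights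
  \<open>r k * pmf (n k) x / pmf \<nu> x\<close>. They sum to 1, so the constant \<open>c\<close>,
  later the logarithm of the degree of \<open>x\<close>, passes through the average.\<close>

lemma neg_entropy_mixture_le:
  assumes adm: "(n, r, F, q) \<in> admissible V E x0 \<nu>" and \<nu>: "\<nu> \<in> prob_on V"
    and p: "\<And>y. pmf \<nu> x * pmf p y = (\<Sum>k\<in>{1..card E}. r k * pmf (n k) x * pmf (q k x) y)"
  shows "pmf \<nu> x * (neg_entropy V p + c)
    \<le> (\<Sum>k\<in>{1..card E}. r k * pmf (n k) x * (neg_entropy V (q k x) + c))"
proof (cases "pmf \<nu> x = 0")
  case True
  have "(\<Sum>k\<in>{1..card E}. r k * pmf (n k) x * (neg_entropy V (q k x) + c)) = 0"
    using adm_weight_zero[OF adm \<nu> True] by (intro sum.neutral) auto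
  then show ?thesis using True by simp
next
  case False
  let ?K = "{1..card E}"
  define w where "w k = r k * pmf (n k) x / pmf \<nu> x" for k
  have w: "w k \<ge> 0" if "k \<in> ?K" for k using adm_r(1)[OF adm that] by (simp add: w_def)
  have w1: "sum w ?K = 1"
    using adm_mixture[OF adm \<nu>, of x] False by (simp add: w_def flip: sum_divide_distrib)
  have p': "pmf p y = (\<Sum>k\<in>?K. w k * pmf (q k x) y)" for y
    using p[of y] False by (simp add: w_def field_simps flip: sum_divide_distrib)
  have "neg_entropy V p \<le> (\<Sum>y\<in>V. \<Sum>k\<in>?K. w k * (pmf (q k x) y * ln (pmf (q k x) y)))"
    unfolding neg_entropy_def p' using w w1 by (intro sum_mono xlnx_jensen) auto
  also have "\<dots> = (\<Sum>k\<in>?K. w k * neg_entropy V (q k x))"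
    by (subst sum.swap) (simp add: neg_entropy_def sum_distrib_left)
  finally have "neg_entropy V p + c \<le> (\<Sum>k\<in>?K. w k * neg_entropy V (q k x)) + c * sum w ?K"
    unfolding w1 by simp
  also have "\<dots> = (\<Sum>k\<in>?K. w k * (neg_entropy V (q k x) + c))"
    by (simp add: distrib_left sum.distrib sum_distrib_left mult.commute)
  finally have "pmf \<nu> x * (neg_entropy V p + c) \<le> pmf \<nu> x * (\<Sum>k\<in>?K. w k * (neg_entropy V (q k x) + c))"
    by (intro mult_left_mono) auto
  then show ?thesis using False by (simp add: sum_distrib_left w_def)
qed

text \<open>For \<open>\<delta> \<le> 1\<close> it pays to merge all stages into the last one, where \<open>F (card E) = E\<close> makes
  the cost independent of \<open>\<delta>\<close>; the family keeps its edge sequence.\<close>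

lemma last_stage_family:
  assumes adm: "(n, r, F, q) \<in> admissible V E x0 \<nu>" and \<nu>: "\<nu> \<in> prob_on V"
    and "0 < \<delta>" "\<delta> \<le> 1" "0 < \<delta>'"
  shows "\<exists>n' r' q'. (n', r', F, q') \<in> admissible V E x0 \<nu> \<and>
    family_cost V E \<delta>' n' r' F q' \<le> family_cost V E \<delta> n r F q"
proof -
  let ?K = "{1..card E}" and ?b = "card E"
  obtain p where p: "\<And>x y. pmf \<nu> x * pmf (p x) y = (\<Sum>k\<in>?K. r k * pmf (n k) x * pmf (q k x) y)"
    using mixed_kernel_exists[OF adm \<nu>] by metis
  \<comment> \<open>Off the support of \<open>\<nu>\<close> the kernel \<open>p x\<close> is
    arbitrary and may leave the graph, so the old last-stage kernel, which moves along
    \<open>E\<close>, is kept there.\<close>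
  define p' where "p' x = (if x \<in> set_pmf \<nu> then p x else q ?b x)" for x
  have b: "?b \<in> ?K" using card_E_pos by simp
  have Fb: "F ?b = E" using edge_seqs_last[OF admF[OF adm]] .
  have p'_edge: "{x, y} \<in> E" if "x \<in> set_pmf \<nu>" "y \<in> set_pmf (p x)" for x y
  proof -
    have "pmf \<nu> x * pmf (p x) y > 0" using that by (simp add: pmf_positive)
    then have "(\<Sum>k\<in>?K. r k * pmf (n k) x * pmf (q k x) y) \<noteq> 0" using p by simp
    then obtain k where k: "k \<in> ?K" "r k * pmf (n k) x * pmf (q k x) y \<noteq> 0"
      by (rule sum.not_neutral_contains_not_neutral)
    then have "{x, y} \<in> F k" using adm_q_edge[OF adm k(1)] by (auto simp: set_pmf_iff)
    then show ?thesis using edge_seqsD(1)[OF admF[OF adm] k(1)] by blast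
  qed
  have trans: "p' \<in> transitions V E"
  proof -
    have "p' x \<in> prob_on V \<and> (\<forall>y\<in>V. pmf (p' x) y > 0 \<longrightarrow> {x, y} \<in> E)" if "x \<in> V" for x
    proof (cases "x \<in> set_pmf \<nu>")
      case True
      then have "{x, y} \<in> E" if "y \<in> set_pmf (p' x)" for y using that p'_edge by (simp add: p'_def)
      then show ?thesis using edge_in_V(2) by (fastforce simp: prob_on_def set_pmf_iff)
    next
      case False
      then show ?thesis using adm_q[OF adm b] that by (auto simp: p'_def transitions_def Fb Union_E)
    qed
    then show ?thesis by (simp add: transitions_def Union_E)
  qed
  have stat: "bind_pmf \<nu> p' = \<nu>"
  proof (rule pmf_eqI)
    fix y
    have "pmf (bind_pmf \<nu> p') y = (\<Sum>x\<in>V. pmf (p' x) y * pmf \<nu> x)"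
      unfolding pmf_bind using \<nu> finite_V by (intro integral_measure_pmf_real) (auto simp: prob_on_def)
    also have "\<dots> = (\<Sum>x\<in>V. pmf \<nu> x * pmf (p x) y)"
      by (intro sum.cong) (auto simp: p'_def set_pmf_iff)
    \<comment> \<open>Exchanging the sums turns one step of the mixed kernel into the mixture of one
      step of each stage, and every stage is stationary.\<close>
    also have "\<dots> = (\<Sum>k\<in>?K. r k * (\<Sum>x\<in>V. pmf (q k x) y * pmf (n k) x))"
      unfolding p by (subst sum.swap) (simp add: sum_distrib_left mult_ac)
    also have "\<dots> = (\<Sum>k\<in>?K. r k * pmf (bind_pmf (n k) (q k)) y)"
      unfolding pmf_bind using adm_n(3)[OF adm] finite_V
      by (intro sum.cong refl arg_cong2[where f = "(*)"] integral_measure_pmf_real[symmetric]) blast+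
    also have "\<dots> = (\<Sum>k\<in>?K. r k * pmf (n k) y)"
      using adm_n(1)[OF adm] by (intro sum.cong) auto
    also have "\<dots> = pmf \<nu> y" by (rule adm_mixture[OF adm \<nu>])
    finally show "pmf (bind_pmf \<nu> p') y = pmf \<nu> y" .
  qed
  \<comment> \<open>Earlier stages keep their measures and kernels, since admissibility constrains
    stages of weight 0 as well.\<close>
  let ?n = "n(?b := \<nu>)" and ?r = "\<lambda>k. if k = ?b then 1 else 0 :: real" and ?q = "q(?b := p')"
  have adm': "(?n, ?r, F, ?q) \<in> admissible V E x0 \<nu>"
    using adm trans stat \<nu> card_E_pos
    by (auto simp: admissible_def Fb Union_E if_distrib[of "\<lambda>c. c * _"] cong: if_cong)
  let ?d = "\<lambda>x. ln (real (card (nbrs V E x)))"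
  have "family_cost V E \<delta>' ?n ?r F ?q
      = (\<Sum>k\<in>?K. if k = ?b then \<Sum>x\<in>V. ennreal (pmf \<nu> x) * ennreal (neg_entropy V (p' x) + ?d x) else 0)"
    unfolding family_cost_eq[OF adm' \<open>0 < \<delta>'\<close>]
    by (intro sum.cong refl) (auto simp: Fb eff_degree_full)
  also have "\<dots> = (\<Sum>x\<in>V. ennreal (pmf \<nu> x * (neg_entropy V (p x) + ?d x)))"
    using b by (auto simp: p'_def set_pmf_iff ennreal_mult' intro!: sum.cong)
  also have "\<dots> \<le> (\<Sum>x\<in>V. ennreal (\<Sum>k\<in>?K. r k * pmf (n k) x * (neg_entropy V (q k x) + ?d x)))"
    by (intro sum_mono ennreal_leI neg_entropy_mixture_le[OF adm \<nu> p])
  also have "\<dots> \<le> (\<Sum>x\<in>V. \<Sum>k\<in>?K. ennreal (r k * pmf (n k) x * (neg_entropy V (q k x) + ?d x)))"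
    by (intro sum_mono ennreal_sum_le)
  also have "\<dots> \<le> (\<Sum>x\<in>V. \<Sum>k\<in>?K. ennreal (r k * pmf (n k) x *
      (neg_entropy V (q k x) + ln (eff_degree V E \<delta> (F k) x))))"
  proof (intro sum_mono ennreal_leI mult_left_mono add_left_mono)
    fix x k assume "x \<in> V" and k: "k \<in> ?K"
    show "0 \<le> r k * pmf (n k) x" using adm_r(1)[OF adm k] by simp
    have "0 < real (card (nbrs V E x))"
      using eff_degree_pos[of 1 x E] \<open>x \<in> V\<close> by (simp add: eff_degree_full)
    then show "?d x \<le> ln (eff_degree V E \<delta> (F k) x)"
      using eff_degree_ge_card[OF \<open>0 < \<delta>\<close> \<open>\<delta> \<le> 1\<close>] by (intro ln_mono) auto
  qed
  also have "\<dots> = family_cost V E \<delta> n r F q"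
    unfolding family_cost_eq[OF adm \<open>0 < \<delta>\<close>] using adm_r(1)[OF adm]
    by (subst sum.swap) (intro sum.cong refl ennreal_mult', simp)
  finally show ?thesis using adm' by blast
qed

text \<open>A merged family has the same cost for every parameter, so \<open>\<delta>'\<close> may
  be any positive number. Setting \<open>\<delta>\<close> or \<open>\<delta>'\<close> to 1 yields
  the two inequalities behind constancy on \<open>(0, 1]\<close>.\<close>

lemma rate_le_of_le_1:
  assumes "\<nu> \<in> prob_on V" "0 < \<delta>" "\<delta> \<le> 1" "0 < \<delta>'"
  shows "rate V E x0 \<delta>' \<nu> \<le> rate V E x0 \<delta> \<nu>"
proof (rule le_rateI)
  fix n r F q assume "(n, r, F, q) \<in> admissible V E x0 \<nu>"
  from last_stage_family[OF this assms] obtain n' r' q' where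
    "(n', r', F, q') \<in> admissible V E x0 \<nu>"
    "family_cost V E \<delta>' n' r' F q' \<le> family_cost V E \<delta> n r F q" by blast
  then show "rate V E x0 \<delta>' \<nu> \<le> enn2ereal (family_cost V E \<delta> n r F q)"
    using rate_le[of n' r' F q' V E x0 \<nu> \<delta>'] by (simp add: less_eq_ennreal.rep_eq order_trans)
qed

lemma rate_eq_max_1:
  assumes "\<nu> \<in> prob_on V" "0 < \<delta>"
  shows "rate V E x0 \<delta> \<nu> = rate V E x0 (max \<delta> 1) \<nu>"
  using rate_le_of_le_1[of \<nu> \<delta> 1] rate_le_of_le_1[of \<nu> 1 \<delta>] assms
  by (cases "\<delta> \<le> 1") (auto simp: max_def)

lemma rate_antimono:
  assumes "0 < \<delta>1" "\<delta>1 \<le> \<delta>2"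
  shows "rate V E x0 \<delta>2 \<nu> \<le> rate V E x0 \<delta>1 \<nu>"
proof (rule le_rateI)
  fix n r F q assume adm: "(n, r, F, q) \<in> admissible V E x0 \<nu>"
  have "rate V E x0 \<delta>2 \<nu> \<le> enn2ereal (family_cost V E \<delta>2 n r F q)" by (rule rate_le[OF adm])
  also have "\<dots> \<le> enn2ereal (family_cost V E \<delta>1 n r F q)"
    using family_cost_antimono[OF adm assms] by (simp add: less_eq_ennreal.rep_eq)
  finally show "rate V E x0 \<delta>2 \<nu> \<le> enn2ereal (family_cost V E \<delta>1 n r F q)" .
qed

lemma rate_lipschitz:
  assumes "1 \<le> \<delta>1" "\<delta>1 \<le> \<delta>2"
  shows "rate V E x0 \<delta>1 \<nu> \<le> rate V E x0 \<delta>2 \<nu> + ereal (\<delta>2 - \<delta>1)"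
proof -
  \<comment> \<open>With the increment on the left the claim is a lower bound for an infimum, to be
    checked family by family.\<close>
  have "rate V E x0 \<delta>1 \<nu> - ereal (\<delta>2 - \<delta>1) \<le> rate V E x0 \<delta>2 \<nu>"
  proof (rule le_rateI)
    fix n r F q assume adm: "(n, r, F, q) \<in> admissible V E x0 \<nu>"
    have "rate V E x0 \<delta>1 \<nu> \<le> enn2ereal (family_cost V E \<delta>1 n r F q)" by (rule rate_le[OF adm])
    also have "\<dots> \<le> enn2ereal (family_cost V E \<delta>2 n r F q + ennreal (\<delta>2 - \<delta>1))"
      using family_cost_lipschitz[OF adm assms] by (simp add: less_eq_ennreal.rep_eq)
    also have "\<dots> = enn2ereal (family_cost V E \<delta>2 n r F q) + ereal (\<delta>2 - \<delta>1)"
      using assms by (simp add: plus_ennreal.rep_eq enn2ereal_ennreal)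
    finally show "rate V E x0 \<delta>1 \<nu> - ereal (\<delta>2 - \<delta>1) \<le> enn2ereal (family_cost V E \<delta>2 n r F q)"
      by (simp add: ereal_minus_le)
  qed
  then show ?thesis by (simp add: ereal_minus_le)
qed

text \<open>The rate depends on \<open>\<delta>\<close> only through \<open>max \<delta> 1\<close>,
  which is itself 1-Lipschitz, so the bound for parameters at least 1 suffices. Finiteness at 1 and
  antitonicity make the rates real there, so no difference of infinities occurs.\<close>

lemma rate_diff_le:
  assumes \<nu>: "\<nu> \<in> prob_on V" and fin: "rate V E x0 1 \<nu> < \<infinity>" and "0 < \<delta>1" "0 < \<delta>2"
  shows "\<bar>rate V E x0 \<delta>1 \<nu> - rate V E x0 \<delta>2 \<nu>\<bar> \<le> ereal \<bar>\<delta>1 - \<delta>2\<bar>"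
proof -
  have *: "\<bar>rate V E x0 a \<nu> - rate V E x0 b \<nu>\<bar> \<le> ereal (b - a)
      \<and> \<bar>rate V E x0 b \<nu> - rate V E x0 a \<nu>\<bar> \<le> ereal (b - a)" if "1 \<le> a" "a \<le> b" for a b
  proof -
    have "rate V E x0 a \<nu> \<noteq> \<infinity>" "rate V E x0 b \<nu> \<noteq> \<infinity>"
      using rate_antimono[of 1 a \<nu>] rate_antimono[of 1 b \<nu>] that fin by auto
    moreover have "rate V E x0 a \<nu> \<noteq> -\<infinity>" "rate V E x0 b \<nu> \<noteq> -\<infinity>"
      using rate_nonneg[of V E x0 _ \<nu>] by auto
    ultimately show ?thesis
      using rate_antimono[of a b \<nu>] rate_lipschitz[OF that, of \<nu>] that
      by (cases "rate V E x0 a \<nu>"; cases "rate V E x0 b \<nu>") auto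
  qed
  have **: "\<bar>rate V E x0 a \<nu> - rate V E x0 b \<nu>\<bar> \<le> ereal \<bar>a - b\<bar>" if "1 \<le> a" "1 \<le> b" for a b
    using *[of a b] *[of b a] that by (cases "a \<le> b") (auto simp: abs_if)
  have "\<bar>rate V E x0 \<delta>1 \<nu> - rate V E x0 \<delta>2 \<nu>\<bar> \<le> ereal \<bar>max \<delta>1 1 - max \<delta>2 1\<bar>"
    unfolding rate_eq_max_1[OF \<nu> \<open>0 < \<delta>1\<close>] rate_eq_max_1[OF \<nu> \<open>0 < \<delta>2\<close>]
    by (intro **) auto
  also have "\<dots> \<le> ereal \<bar>\<delta>1 - \<delta>2\<bar>" by (simp add: max_def)
  finally show ?thesis .
qed

subsection \<open>The uniform measure on an edge\<close>

text \<open>Otherwise the endpoints of \<open>H\<close> are closed under adjacency and exhaust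
  \<open>V\<close>, but then any edge outside \<open>H\<close> meets an edge of
  \<open>H\<close>.\<close>

lemma extending_edge_exists:
  assumes "H \<subset> E" "H \<noteq> {}"
  shows "\<exists>e. e \<in> E - H \<and> (\<exists>e'\<in>H. e \<inter> e' \<noteq> {})"
proof (rule ccontr)
  assume *: "\<not> ?thesis"
  obtain e where "e \<in> H" using assms by blast
  then obtain u where u: "u \<in> \<Union>H" "u \<in> V" using assms by (metis UnionI edge_cases insertI1 psubsetD)
  have "V \<subseteq> \<Union>H"
    by (rule adjacency_closed_imp_superset[OF u]) (use * in blast)
  moreover obtain e where e: "e \<in> E - H" using assms by blast
  moreover obtain x y where "e = {x, y}" "x \<in> V" using edge_cases e by (metis DiffD1)
  ultimately show False using * by blast
qed

lemma edge_seq_exists: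
  assumes "{x0, v} \<in> E"
  shows "\<exists>F\<in>edge_seqs V E x0. F 1 = {{x0, v}}"
proof -
  define ext where "ext H = (SOME e. e \<in> E - H \<and> (\<exists>e'\<in>H. e \<inter> e' \<noteq> {}))" for H
  define H where "H = rec_nat {{x0, v}} (\<lambda>_ K. insert (ext K) K)"
  have H0: "H 0 = {{x0, v}}" and HS: "H (Suc k) = insert (ext (H k)) (H k)" for k
    by (simp_all add: H_def)
  have ext: "ext K \<in> E - K" "\<exists>e'\<in>K. ext K \<inter> e' \<noteq> {}" if "K \<subset> E" "K \<noteq> {}" for K
    using someI_ex[OF extending_edge_exists[OF that]] by (auto simp: ext_def)
  have H: "H k \<subseteq> E \<and> card (H k) = Suc k" if "k < card E" for k
    using that
  proof (induction k)
    case 0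
    then show ?case using assms by (simp add: H0)
  next
    case (Suc k)
    then have k: "H k \<subseteq> E" "card (H k) = Suc k" by auto
    then have "H k \<subset> E" "H k \<noteq> {}" using Suc.prems by auto
    from ext(1)[OF this] k finite_subset[OF k(1) finite_E] show ?case by (simp add: HS)
  qed
  have ext_H: "\<exists>e'\<in>H k. ext (H k) \<inter> e' \<noteq> {}" if "Suc k < card E" for k
    using H[of k] that by (intro ext(2)) auto
  \<comment> \<open>\<open>H\<close> starts at index 0 with one edge, whereas edge sequences are
    indexed by their cardinality.\<close>
  define F where "F k = H (k - 1)" for k
  have "F \<in> edge_seqs V E x0"
    unfolding edge_seqs_def
  proof (intro CollectI conjI ballI)
    fix k assume "k \<in> {1..card E}"
    then have "k - 1 < card E" "Suc (k - 1) = k" by auto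
    then show "F k \<subseteq> E" "card (F k) = k" using H[of "k - 1"] by (simp_all add: F_def)
  next
    fix k assume k: "k \<in> {1..<card E}"
    then have S: "F (Suc k) = insert (ext (F k)) (F k)" using HS[of "k - 1"] by (simp add: F_def)
    then show "F k \<subseteq> F (Suc k)" by blast
    fix e assume "e \<in> F (Suc k) - F k"
    then have "e = ext (F k)" using S by blast
    then show "\<exists>e'\<in>F k. e \<inter> e' \<noteq> {}" using ext_H[of "k - 1"] k by (simp add: F_def)
  next
    show "\<exists>v\<in>V. F 1 = {{x0, v}}" using assms edge_in_V(2) by (auto simp: F_def H0)
  qed
  moreover have "F 1 = {{x0, v}}" by (simp add: F_def H0)
  ultimately show ?thesis by blast
qed

text \<open>The logarithm of the effective degree of \<open>x\<close> when exactly one edge at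
  \<open>x\<close> is explored. For \<open>\<delta> \<ge> 1\<close> it bounds from below the entropy
  of a deterministic move from \<open>x\<close> along an explored edge.\<close>

definition min_cost :: "real \<Rightarrow> 'a \<Rightarrow> real" where
  "min_cost \<delta> x = ln (1 + (real (card (nbrs V E x)) - 1) / \<delta>)"

lemma card_nbrs_ge_1:
  assumes "{x, y} \<in> E" shows "1 \<le> real (card (nbrs V E x))"
proof -
  have "y \<in> nbrs V E x" using assms edge_in_V(2)[of x y] by (simp add: nbrs_def)
  then have "card (nbrs V E x) > 0" using finite_nbrs[of x] by (auto simp: card_gt_0_iff)
  then show ?thesis by simp
qed

context
  fixes v
  assumes edge: "{x0, v} \<in> E"
begin

abbreviation "edge_pmf \<equiv> pmf_of_set {x0, v}"

lemma v: "v \<in> V" "x0 \<noteq> v" "{v, x0} \<in> E"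
  using edge edge_in_V(2) edge_neq by (auto simp: insert_commute)

lemma set_edge_pmf: "set_pmf edge_pmf = {x0, v}"
  by simp

lemma pmf_edge_pmf: "pmf edge_pmf x = (if x = x0 \<or> x = v then 1 / 2 else 0)"
  using v by (simp add: indicator_def)

lemma edge_pmf_in: "edge_pmf \<in> prob_on V"
  using v x0 by (simp add: prob_on_def)

lemma min_cost_sum:
  assumes "1 \<le> \<delta>"
  shows "(\<Sum>x\<in>V. ennreal (pmf edge_pmf x) * ennreal (min_cost \<delta> x))
    = ennreal ((min_cost \<delta> x0 + min_cost \<delta> v) / 2)"
proof -
  have nonneg: "0 \<le> min_cost \<delta> x0" "0 \<le> min_cost \<delta> v"
    using card_nbrs_ge_1[OF edge] card_nbrs_ge_1[OF v(3)] assms by (auto simp: min_cost_def)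
  have "(\<Sum>x\<in>V. ennreal (pmf edge_pmf x) * ennreal (min_cost \<delta> x))
      = (\<Sum>x\<in>{x0, v}. ennreal (pmf edge_pmf x) * ennreal (min_cost \<delta> x))"
    using v x0 finite_V by (intro sum.mono_neutral_right) (auto simp: pmf_edge_pmf simp del: pmf_of_set)
  also have "\<dots> = ennreal (1 / 2 * min_cost \<delta> x0) + ennreal (1 / 2 * min_cost \<delta> v)"
    using v by (simp only: ennreal_mult') (simp add: pmf_edge_pmf del: pmf_of_set)
  also have "\<dots> = ennreal ((min_cost \<delta> x0 + min_cost \<delta> v) / 2)"
    using nonneg by (subst ennreal_plus[symmetric]) (auto simp: field_simps)
  finally show ?thesis .
qed

text \<open>Stationarity and the absence of loops force every stage with positive weight to jump
  back and forth along the single edge.\<close>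

lemma edge_pmf_cost_ge:
  assumes adm: "(n, r, F, q) \<in> admissible V E x0 edge_pmf" and "1 \<le> \<delta>"
  shows "ennreal ((min_cost \<delta> x0 + min_cost \<delta> v) / 2) \<le> family_cost V E \<delta> n r F q"
proof -
  let ?K = "{1..card E}"
  have supp: "x \<in> {x0, v}" if "k \<in> ?K" "r k \<noteq> 0" "x \<in> set_pmf (n k)" for k x
  proof (rule ccontr)
    assume "x \<notin> {x0, v}"
    then have "pmf edge_pmf x = 0" by (simp add: pmf_edge_pmf del: pmf_of_set)
    then have "r k * pmf (n k) x = 0" by (rule adm_weight_zero[OF adm edge_pmf_in _ \<open>k \<in> ?K\<close>])
    then show False using that by (simp add: set_pmf_iff)
  qed
  have le: "ennreal (r k * pmf (n k) x) * ennreal (min_cost \<delta> x) \<le> ennreal (r k * pmf (n k) x) *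
      ennreal (neg_entropy V (q k x) + ln (eff_degree V E \<delta> (F k) x))" if k: "k \<in> ?K" for k x
  proof (cases "r k * pmf (n k) x = 0")
    case False
    then have r: "r k \<noteq> 0" and xn: "x \<in> set_pmf (n k)" by (auto simp: set_pmf_iff)
    have FE: "F k \<subseteq> E" using edge_seqsD(1)[OF admF[OF adm] k] .
    obtain y where y: "{x0, v} = {x, y}" using supp[OF k r xn] by blast
    \<comment> \<open>By stationarity \<open>z\<close> lies in the support of \<open>n k\<close>,
      hence in \<open>{x, y}\<close>, and a loop at \<open>x\<close> is impossible.\<close>
    have "z = y" if z: "z \<in> set_pmf (q k x)" for z
    proof -
      have "z \<in> set_pmf (bind_pmf (n k) (q k))" using z xn by auto
      then have "z \<in> {x, y}" using supp[OF k r] adm_n(1)[OF adm k] y by simp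
      moreover have "z \<noteq> x" using adm_q_edge[OF adm k xn z] FE edge_neq by blast
      ultimately show ?thesis by simp
    qed
    then have "q k x = return_pmf y" by (simp add: set_pmf_subset_singleton[symmetric] subset_iff)
    moreover from this have "{x, y} \<in> F k" using adm_q_edge[OF adm k xn, of y] by simp
    ultimately have "neg_entropy V (q k x) = 0"
        and "1 + (real (card (nbrs V E x)) - 1) / \<delta> \<le> eff_degree V E \<delta> (F k) x"
      using eff_degree_ge[OF \<open>1 \<le> \<delta>\<close> _ FE] neg_entropy_return[OF finite_V] by auto
    moreover have "0 < 1 + (real (card (nbrs V E x)) - 1) / \<delta>"
      using card_nbrs_ge_1[of x y] edge y \<open>1 \<le> \<delta>\<close> by (auto intro: add_pos_nonneg)
    ultimately show ?thesis
      by (intro mult_left_mono ennreal_leI) (auto simp: min_cost_def intro: ln_mono)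
  next
    case True
    then show ?thesis by (simp only: ennreal_0 mult_zero_left order_refl)
  qed
  \<comment> \<open>The mass at each point is split over the stages, so that the comparison with the
    cost is termwise.\<close>
  have "ennreal ((min_cost \<delta> x0 + min_cost \<delta> v) / 2)
      = (\<Sum>x\<in>V. \<Sum>k\<in>?K. ennreal (r k * pmf (n k) x) * ennreal (min_cost \<delta> x))"
    unfolding min_cost_sum[OF \<open>1 \<le> \<delta>\<close>, symmetric] stage_weight[OF adm edge_pmf_in, symmetric]
    by (simp add: sum_distrib_right)
  also have "\<dots> \<le> family_cost V E \<delta> n r F q"
    using \<open>1 \<le> \<delta>\<close> by (subst family_cost_eq[OF adm]) (simp, subst sum.swap, intro sum_mono le)
  finally show ?thesis .
qed

text \<open>The optimal family explores only \<open>{x0, v}\<close> in the first stage, which carries all the weight;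
  the later stages have weight \<open>0\<close> but must still be admissible.\<close>

lemma edge_pmf_cost_attained:
  "\<exists>n r F q. (n, r, F, q) \<in> admissible V E x0 edge_pmf \<and> (\<forall>\<delta>\<ge>1.
    family_cost V E \<delta> n r F q = ennreal ((min_cost \<delta> x0 + min_cost \<delta> v) / 2))"
proof -
  let ?K = "{1..card E}"
  obtain F where F: "F \<in> edge_seqs V E x0" and F1: "F 1 = {{x0, v}}"
    using edge_seq_exists[OF edge] by blast
  \<comment> \<open>This places the edge measure on the endpoints of every \<open>F k\<close>, so
    one measure serves all stages.\<close>
  have eF: "{x0, v} \<in> F k" if "k \<in> ?K" for k
  proof -
    have "1 \<le> k \<Longrightarrow> k \<le> card E \<Longrightarrow> {x0, v} \<in> F k"
    proof (induction k rule: dec_induct)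
      case (step k)
      then have "F k \<subseteq> F (Suc k)" using F by (simp add: edge_seqs_def)
      with step show ?case by auto
    qed (use F1 in simp)
    then show ?thesis using that by simp
  qed
  \<comment> \<open>Other endpoints of \<open>F k\<close> carry no mass but still need a legal move;
    \<open>SOME\<close> picks an explored edge there.\<close>
  define q where "q k x = return_pmf (if x = x0 then v else if x = v then x0 else SOME y. {x, y} \<in> F k)" for k x
  have q_edge: "{x, y} \<in> F k" if "k \<in> ?K" "x \<in> \<Union>(F k)" "y \<in> set_pmf (q k x)" for k x y
  proof -
    obtain e where e: "e \<in> F k" "x \<in> e" using \<open>x \<in> \<Union>(F k)\<close> by blast
    then have "e \<in> E" using edge_seqsD(1)[OF F \<open>k \<in> ?K\<close>] by blast
    then obtain z where "e = {x, z}" using e(2) by (auto elim!: edge_cases)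
    then have "\<exists>y. {x, y} \<in> F k" using e(1) by blast
    then show ?thesis using eF[OF \<open>k \<in> ?K\<close>] that(3) someI_ex[of "\<lambda>y. {x, y} \<in> F k"]
      by (auto simp: q_def insert_commute split: if_splits)
  qed
  have trans: "q k \<in> transitions V (F k)" if "k \<in> ?K" for k
  proof -
    have "{x, y} \<in> F k \<and> y \<in> V" if "x \<in> \<Union>(F k)" "y \<in> set_pmf (q k x)" for x y
      using q_edge[OF \<open>k \<in> ?K\<close> that] edge_seqsD(1)[OF F \<open>k \<in> ?K\<close>] edge_in_V(2) by blast
    then show ?thesis by (auto simp: transitions_def prob_on_def pmf_positive_iff)
  qed
  have stat: "bind_pmf edge_pmf (q k) = edge_pmf" for k
  proof (rule pmf_eqI)
    fix y
    have "pmf (bind_pmf edge_pmf (q k)) y = (\<Sum>x\<in>{x0, v}. pmf (q k x) y) / real (card {x0, v})"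
      by (rule pmf_bind_pmf_of_set) auto
    also have "\<dots> = pmf edge_pmf y"
      using v by (auto simp: q_def pmf_edge_pmf pmf_return indicator_def simp del: pmf_of_set)
    finally show "pmf (bind_pmf edge_pmf (q k)) y = pmf edge_pmf y" .
  qed
  let ?r = "\<lambda>k. if k = 1 then 1 else 0 :: real"
  have one: "1 \<in> ?K" using card_E_pos by simp
  have adm: "(\<lambda>_. edge_pmf, ?r, F, q) \<in> admissible V E x0 edge_pmf"
    unfolding admissible_def mem_Collect_eq prod.case
  proof (intro conjI ballI)
    show "(\<Sum>k\<in>?K. ?r k) = 1" using one by simp
    show "(\<Sum>k\<in>?K. ?r k * pmf edge_pmf x) = pmf edge_pmf x" for x
    proof -
      have "(\<Sum>k\<in>?K. ?r k * pmf edge_pmf x) = (\<Sum>k\<in>?K. if k = 1 then pmf edge_pmf x else 0)"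
        by (intro sum.cong) auto
      then show ?thesis using one by simp
    qed
    show "edge_pmf \<in> prob_on (\<Union>(F k))" if "k \<in> ?K" for k
    proof -
      have "{x0, v} \<subseteq> \<Union>(F k)" using eF[OF that] by (rule Union_upper)
      then show ?thesis by (simp only: prob_on_def set_edge_pmf mem_Collect_eq)
    qed
    show "?r k \<ge> 0" for k by simp
    show "bind_pmf edge_pmf (q k) = edge_pmf" for k by (rule stat)
    show "q k \<in> transitions V (F k)" if "k \<in> ?K" for k using that by (rule trans)
  qed (rule F)
  moreover have "family_cost V E \<delta> (\<lambda>_. edge_pmf) ?r F q = ennreal ((min_cost \<delta> x0 + min_cost \<delta> v) / 2)"
    if "1 \<le> \<delta>" for \<delta>
  proof -
    have *: "ennreal (pmf edge_pmf x) * ennreal (neg_entropy V (q 1 x) + ln (eff_degree V E \<delta> (F 1) x))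
      = ennreal (pmf edge_pmf x) * ennreal (min_cost \<delta> x)" for x
    proof (cases "x \<in> {x0, v}")
      case True
      then have "eff_degree V E \<delta> (F 1) x = 1 + (real (card (nbrs V E x)) - 1) / \<delta>"
        unfolding F1 using eff_degree_edge[OF edge] eff_degree_edge[OF v(3)] by (auto simp: insert_commute)
      moreover have "neg_entropy V (q 1 x) = 0"
        unfolding q_def by (rule neg_entropy_return[OF finite_V])
      ultimately show ?thesis by (simp only: min_cost_def add_0)
    next
      case False
      then have "pmf edge_pmf x = 0" by (simp add: pmf_edge_pmf del: pmf_of_set)
      then show ?thesis by (simp only: ennreal_0 mult_zero_left)
    qed
    have "family_cost V E \<delta> (\<lambda>_. edge_pmf) ?r F q
        = (\<Sum>k\<in>?K. if k = 1 then \<Sum>x\<in>V. ennreal (pmf edge_pmf x) * ennreal (min_cost \<delta> x) else 0)"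
      unfolding family_cost_eq[OF adm less_le_trans[OF zero_less_one that]] *[symmetric]
      by (intro sum.cong refl) (simp del: pmf_of_set)
    also have "\<dots> = (\<Sum>x\<in>V. ennreal (pmf edge_pmf x) * ennreal (min_cost \<delta> x))"
      using one by simp
    finally show ?thesis using min_cost_sum[OF that] by simp
  qed
  ultimately show ?thesis by blast
qed

lemma rate_edge_pmf:
  assumes "1 \<le> \<delta>"
  shows "rate V E x0 \<delta> edge_pmf = ereal ((min_cost \<delta> x0 + min_cost \<delta> v) / 2)"
proof -
  have nonneg: "0 \<le> (min_cost \<delta> x0 + min_cost \<delta> v) / 2"
    using card_nbrs_ge_1[OF edge] card_nbrs_ge_1[OF v(3)] assms by (auto simp: min_cost_def)
  have "rate V E x0 \<delta> edge_pmf = enn2ereal (ennreal ((min_cost \<delta> x0 + min_cost \<delta> v) / 2))"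
  proof (rule antisym)
    from edge_pmf_cost_attained obtain n r F q where
      adm: "(n, r, F, q) \<in> admissible V E x0 edge_pmf" and
      "family_cost V E \<delta> n r F q = ennreal ((min_cost \<delta> x0 + min_cost \<delta> v) / 2)"
      using assms by blast
    then show "rate V E x0 \<delta> edge_pmf \<le> enn2ereal (ennreal ((min_cost \<delta> x0 + min_cost \<delta> v) / 2))"
      using rate_le[OF adm, of \<delta>] by simp
    show "enn2ereal (ennreal ((min_cost \<delta> x0 + min_cost \<delta> v) / 2)) \<le> rate V E x0 \<delta> edge_pmf"
      using edge_pmf_cost_ge assms by (intro le_rateI) (simp add: less_eq_ennreal.rep_eq[symmetric])
  qed
  then show ?thesis using nonneg by (simp add: enn2ereal_ennreal)
qed

text \<open>If both degrees were 1, then \<open>{x0, v}\<close> would be closed under adjacency and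
  contain all of \<open>V\<close>, which has at least three points.\<close>

lemma card_nbrs_gt_1: "1 < card (nbrs V E x0) \<or> 1 < card (nbrs V E v)"
proof (rule ccontr)
  assume *: "\<not> ?thesis"
  have in_nbrs: "v \<in> nbrs V E x0" "x0 \<in> nbrs V E v" using edge v x0 by (auto simp: nbrs_def)
  have "z = v" if "z \<in> nbrs V E x0" for z
    using * card_le_Suc0_iff_eq[OF finite_nbrs[of x0]] in_nbrs that by auto
  moreover have "z = x0" if "z \<in> nbrs V E v" for z
    using * card_le_Suc0_iff_eq[OF finite_nbrs[of v]] in_nbrs that by auto
  ultimately have "V \<subseteq> {x0, v}"
    using x0 edge_in_V(2) by (intro adjacency_closed_imp_superset[of x0]) (auto simp: nbrs_def)
  then have "card V \<le> card {x0, v}" by (intro card_mono) auto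
  then show False using card_V v by simp
qed

lemma min_cost_strict_antimono:
  assumes "1 \<le> \<delta>1" "\<delta>1 < \<delta>2"
  shows "min_cost \<delta>2 x0 + min_cost \<delta>2 v < min_cost \<delta>1 x0 + min_cost \<delta>1 v"
proof -
  have le: "ln (1 + a / \<delta>2) \<le> ln (1 + a / \<delta>1)" if "0 \<le> a" for a :: real
    using assms that by (intro ln_mono) (auto intro: add_pos_nonneg divide_left_mono)
  have less: "ln (1 + a / \<delta>2) < ln (1 + a / \<delta>1)" if "0 < a" for a :: real
    using assms that by (intro ln_less_cancel_iff[THEN iffD2]) (auto intro: add_pos_nonneg divide_strict_left_mono)
  show ?thesis
    using card_nbrs_gt_1 card_nbrs_ge_1[OF edge] card_nbrs_ge_1[OF v(3)]
      le[of "real (card (nbrs V E x0)) - 1"] less[of "real (card (nbrs V E x0)) - 1"]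
      le[of "real (card (nbrs V E v)) - 1"] less[of "real (card (nbrs V E v)) - 1"]
    unfolding min_cost_def by linarith
qed

lemma rate_edge_pmf_not_differentiable:
  "\<not> (\<lambda>\<delta>. real_of_ereal (rate V E x0 \<delta> edge_pmf)) differentiable (at 1)"
proof (rule not_differentiable_kink)
  let ?a = "real (card (nbrs V E x0)) - 1" and ?b = "real (card (nbrs V E v)) - 1"
  let ?h = "\<lambda>\<delta>. (min_cost \<delta> x0 + min_cost \<delta> v) / 2"
  show "real_of_ereal (rate V E x0 \<delta> edge_pmf) = ?h \<delta>" if "1 \<le> \<delta>" for \<delta>
    using rate_edge_pmf[OF that] by simp
  \<comment> \<open>Here \<open>max \<delta> 1 = 1\<close>, so the rate is frozen at its value for
    parameter 1.\<close>
  show "real_of_ereal (rate V E x0 \<delta> edge_pmf) = ?h 1" if "0 < \<delta>" "\<delta> \<le> 1" for \<delta>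
    using rate_eq_max_1[OF edge_pmf_in that(1)] that rate_edge_pmf[of 1] by (simp add: max_def)
  have nonneg: "0 \<le> ?a" "0 \<le> ?b" and pos: "0 < ?a \<or> 0 < ?b"
    using card_nbrs_ge_1[OF edge] card_nbrs_ge_1[OF v(3)] card_nbrs_gt_1 by auto
  \<comment> \<open>With \<open>c\<close> a degree minus 1 the slope is never positive, and it is
    negative as soon as the degree exceeds 1.\<close>
  have ln: "((\<lambda>\<delta>. ln (1 + c / \<delta>)) has_real_derivative - c / (1 + c)) (at 1)" if "0 \<le> c" for c :: real
    using that by (auto intro!: derivative_eq_intros simp: field_simps)
  show "(?h has_real_derivative (- ?a / (1 + ?a) + - ?b / (1 + ?b)) / 2) (at 1)"
    unfolding min_cost_def by (intro DERIV_cdivide DERIV_add ln nonneg)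
  have "0 \<le> ?a / (1 + ?a)" "0 \<le> ?b / (1 + ?b)" "0 < ?a / (1 + ?a) \<or> 0 < ?b / (1 + ?b)"
    using nonneg pos by auto
  then show "(- ?a / (1 + ?a) + - ?b / (1 + ?b)) / 2 \<noteq> 0"
    unfolding minus_divide_left[symmetric] by auto
qed

end

end

text \<open>The last assertion includes finiteness for every \<open>\<delta> > 0\<close>, because
  \<open>real_of_ereal\<close> maps infinite values to 0 and could otherwise create a spurious
  jump.\<close>

theorem theorem2p7:
  fixes V :: "'a set" and E :: "'a set set" and x0 :: 'a
  assumes "finite_simple_graph V E" and "connected_graph V E"
    and "card V \<ge> 3" and "x0 \<in> V"
  shows
    "(\<forall>\<delta>::real. 0 < \<delta> \<and> \<delta> < 1 \<longrightarrow>
        (\<forall>\<mu>\<in>prob_on V. rate V E x0 \<delta> \<mu> = rate V E x0 1 \<mu>)) \<and>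
     (\<forall>\<delta>1 \<delta>2 :: real. 1 \<le> \<delta>1 \<and> \<delta>1 < \<delta>2 \<longrightarrow>
        (\<forall>\<mu>\<in>prob_on V. rate V E x0 \<delta>1 \<mu> \<ge> rate V E x0 \<delta>2 \<mu>) \<and>
        (\<exists>\<mu>0\<in>prob_on V. rate V E x0 \<delta>1 \<mu>0 > rate V E x0 \<delta>2 \<mu>0)) \<and>
     (\<forall>\<epsilon>>0::real. \<exists>\<eta>>0::real. \<forall>\<delta>1>0. \<forall>\<delta>2>0. \<bar>\<delta>1 - \<delta>2\<bar> < \<eta> \<longrightarrow>
        (SUP \<mu>\<in>{\<mu>\<in>prob_on V. rate V E x0 1 \<mu> < \<infinity>}.
           \<bar>rate V E x0 \<delta>1 \<mu> - rate V E x0 \<delta>2 \<mu>\<bar>) < ereal \<epsilon>) \<and>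
     (\<exists>\<mu>\<in>prob_on V. (\<forall>\<delta>>0. rate V E x0 \<delta> \<mu> < \<infinity>) \<and>
        \<not> (\<lambda>\<delta>. real_of_ereal (rate V E x0 \<delta> \<mu>)) differentiable (at 1))"
proof -
  interpret rw_graph V E x0 using assms by unfold_locales
  obtain v where edge: "{x0, v} \<in> E" using neighbour_exists[OF x0] .
  note \<mu>0 = edge_pmf_in[OF edge] and rate_\<mu>0 = rate_edge_pmf[OF edge]
  show ?thesis
  proof (intro conjI allI impI ballI)
    fix \<delta> :: real and \<mu> assume "0 < \<delta> \<and> \<delta> < 1" "\<mu> \<in> prob_on V"
    then show "rate V E x0 \<delta> \<mu> = rate V E x0 1 \<mu>" using rate_eq_max_1[of \<mu> \<delta>] by (simp add: max_def)
  next
    fix \<delta>1 \<delta>2 :: real and \<mu> assume "1 \<le> \<delta>1 \<and> \<delta>1 < \<delta>2"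
    then show "rate V E x0 \<delta>2 \<mu> \<le> rate V E x0 \<delta>1 \<mu>" by (intro rate_antimono) auto
  next
    fix \<delta>1 \<delta>2 :: real assume "1 \<le> \<delta>1 \<and> \<delta>1 < \<delta>2"
    then have "rate V E x0 \<delta>2 (pmf_of_set {x0, v}) < rate V E x0 \<delta>1 (pmf_of_set {x0, v})"
      using min_cost_strict_antimono[OF edge, of \<delta>1 \<delta>2] by (simp add: rate_\<mu>0)
    with \<mu>0 show "\<exists>\<mu>0\<in>prob_on V. rate V E x0 \<delta>1 \<mu>0 > rate V E x0 \<delta>2 \<mu>0" by blast
  next
    fix \<epsilon> :: real assume "0 < \<epsilon>"
    \<comment> \<open>The Lipschitz constant is 1 for every measure, so
      \<open>\<eta> = \<epsilon>\<close> works. Bounding the supremum by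
      \<open>\<bar>\<delta>1 - \<delta>2\<bar>\<close> first keeps the inequality strict.\<close>
    have "(SUP \<mu>\<in>{\<mu>\<in>prob_on V. rate V E x0 1 \<mu> < \<infinity>}. \<bar>rate V E x0 \<delta>1 \<mu> - rate V E x0 \<delta>2 \<mu>\<bar>) < ereal \<epsilon>"
      if "0 < \<delta>1" "0 < \<delta>2" "\<bar>\<delta>1 - \<delta>2\<bar> < \<epsilon>" for \<delta>1 \<delta>2
    proof -
      have "(SUP \<mu>\<in>{\<mu>\<in>prob_on V. rate V E x0 1 \<mu> < \<infinity>}. \<bar>rate V E x0 \<delta>1 \<mu> - rate V E x0 \<delta>2 \<mu>\<bar>)
          \<le> ereal \<bar>\<delta>1 - \<delta>2\<bar>"
        using that by (intro SUP_least rate_diff_le) auto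
      also have "\<dots> < ereal \<epsilon>" using that by simp
      finally show ?thesis .
    qed
    with \<open>0 < \<epsilon>\<close> show "\<exists>\<eta>>0. \<forall>\<delta>1>0. \<forall>\<delta>2>0. \<bar>\<delta>1 - \<delta>2\<bar> < \<eta> \<longrightarrow>
        (SUP \<mu>\<in>{\<mu>\<in>prob_on V. rate V E x0 1 \<mu> < \<infinity>}.
           \<bar>rate V E x0 \<delta>1 \<mu> - rate V E x0 \<delta>2 \<mu>\<bar>) < ereal \<epsilon>"
      by blast
  next
    have "rate V E x0 \<delta> (pmf_of_set {x0, v}) < \<infinity>" if "0 < \<delta>" for \<delta>
      using rate_eq_max_1[OF \<mu>0 that] rate_\<mu>0[of "max \<delta> 1"] by simp
    then show "\<exists>\<mu>\<in>prob_on V. (\<forall>\<delta>>0. rate V E x0 \<delta> \<mu> < \<infinity>) \<and>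
        \<not> (\<lambda>\<delta>. real_of_ereal (rate V E x0 \<delta> \<mu>)) differentiable (at 1)"
      using \<mu>0 rate_edge_pmf_not_differentiable[OF edge] by blast
  qed
qed

end
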